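(* Let $\mathcal F$ be a saturated fusion system on a finite $2$-group $S$, and let $M<S$ be a maximal subgroup. Then $v_M\in B(\mathcal F)^\times$ if and only if $M$ is strongly closed in $\mathcal F$.
   Context: Burnside rings: for a finite group $G$, $B(G)$ is the Grothendieck ring of finite left $G$-sets, with addition $[X]+[Y]=[X\sqcup Y]$ and multiplication $[X][Y]=[X\times Y]$. For $H\leq G$, the map $[X]\mapsto|X^H|$ extends to a ring morphism $B(G)\to\mathbb Z$, written $a\mapsto|a^H|$; the map $a\mapsto(|a^H|)_{H\leq G}$ is injective. For a maximal subgroup $M$ of a $2$-group $S$, $v_M\in B(S)^\times$ denotes the unit with $|v_M^P|=-1$ if $P\leq M$ and $|v_M^P|=1$ otherwise, for all $P\leq S$; explicitly $v_M=[S/S]-[S/M]$. Fusion systems: a fusion system $\mathcal F$ on a finite $p$-group $S$ is a category whose objects are the subgroups of $S$ and whose morphisms are injective group homomorphisms, such that for $P,Q\leq S$ one has $\mathrm{Hom}_S(P,Q)\subseteq\mathrm{Hom}_{\mathcal F}(P,Q)$ (where $\mathrm{Hom}_S(P,Q)$ is the set of homomorphisms given by conjugation by an element of $S$), and every $\varphi\in\mathrm{Hom}_{\mathcal F}(P,Q)$ is the composition of an isomorphism in $\mathcal F$ and an inclusion of subgroups. Subgroups $P,Q$ are $\mathcal F$-conjugate if they are isomorphic in $\mathcal F$. Put $\mathrm{Aut}_{\mathcal F}(P)=\mathrm{Hom}_{\mathcal F}(P,P)$ and $\mathrm{Aut}_S(P)=\mathrm{Hom}_S(P,P)$. $P$ is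 fully $\mathcal F$-automized if $\mathrm{Aut}_S(P)\in\mathrm{Syl}_p(\mathrm{Aut}_{\mathcal F}(P))$, and receptive if every isomorphism $\varphi:Q\to P$ in $\mathcal F$ extends to a morphism in $\mathcal F$ defined on $N_\varphi=\{g\in N_S(Q):\varphi c_g\varphi^{-1}\in\mathrm{Aut}_S(P)\}$, where $c_g$ is conjugation by $g$. $\mathcal F$ is saturated if every subgroup of $S$ is $\mathcal F$-conjugate to one that is fully $\mathcal F$-automized and receptive. Elements $x,y\in S$ are $\mathcal F$-conjugate if there is an isomorphism $\varphi:\langle x\rangle\to\langle y\rangle$ in $\mathcal F$ with $\varphi(x)=y$; $x^{\mathcal F}$ is the $\mathcal F$-conjugacy class of $x$. A subgroup $P\leq S$ is strongly closed in $\mathcal F$ if $x^{\mathcal F}\subseteq P$ for all $x\in P$. The Burnside ring of $\mathcal F$ is the subring $B(\mathcal F)=\{a\in B(S): |a^P|=|a^Q|\text{ whenever }P,Q\leq S\text{ are }\mathcal F\text{-conjugate}\}$, with unit group $B(\mathcal F)^\times$. *)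

theory Defs
  imports
    "HOL-Computational_Algebra.Primes"
    "HOL-Algebra.Group_Action"
    "HOL-Algebra.Left_Coset"
    "HOL-Algebra.Generated_Groups"
    "HOL-Algebra.Ring"
begin

section \<open>Finite G-sets\<close>

text \<open>A pair of an underlying set and an action in the sense of \<^locale>\<open>group_action\<close>.\<close>

type_synonym ('g, 'x) gset = "'x set \<times> ('g \<Rightarrow> 'x \<Rightarrow> 'x)"

definition finite_gset :: "('g, 'm) monoid_scheme \<Rightarrow> ('g, 'x) gset \<Rightarrow> bool"
  where "finite_gset G X \<longleftrightarrow> group_action G (fst X) (snd X) \<and> finite (fst X)"

definition gset_iso :: "('g, 'm) monoid_scheme \<Rightarrow> ('g, 'x) gset \<Rightarrow> ('g, 'y) gset \<Rightarrow> bool"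
  where "gset_iso G X Y \<longleftrightarrow>
    (\<exists>f. bij_betw f (fst X) (fst Y) \<and>
         (\<forall>g\<in>carrier G. \<forall>x\<in>fst X. f (snd X g x) = snd Y g (f x)))"

definition gset_sum :: "('g, 'x) gset \<Rightarrow> ('g, 'y) gset \<Rightarrow> ('g, 'x + 'y) gset"
  where "gset_sum X Y =
    (fst X <+> fst Y, \<lambda>g. \<lambda>z \<in> fst X <+> fst Y. map_sum (snd X g) (snd Y g) z)"

definition gset_prod :: "('g, 'x) gset \<Rightarrow> ('g, 'y) gset \<Rightarrow> ('g, 'x \<times> 'y) gset"
  where "gset_prod X Y =
    (fst X \<times> fst Y, \<lambda>g. \<lambda>z \<in> fst X \<times> fst Y. map_prod (snd X g) (snd Y g) z)"

definition gset_empty :: "('g, nat) gset"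
  where "gset_empty = ({}, \<lambda>g. \<lambda>x \<in> {}. x)"

definition gset_point :: "('g, nat) gset"
  where "gset_point = ({0}, \<lambda>g. \<lambda>x \<in> {0}. x)"

definition gset_cosets :: "('g, 'm) monoid_scheme \<Rightarrow> 'g set \<Rightarrow> ('g, 'g set) gset"
  where "gset_cosets G H = (lcosets\<^bsub>G\<^esub> H, \<lambda>g. \<lambda>C \<in> lcosets\<^bsub>G\<^esub> H. g <#\<^bsub>G\<^esub> C)"

definition gset_fixed :: "('g, 'x) gset \<Rightarrow> 'g set \<Rightarrow> 'x set"
  where "gset_fixed X H = {x \<in> fst X. \<forall>h\<in>H. snd X h x = x}"


section \<open>The Burnside ring\<close>

text \<open>
  Every finite G-set is isomorphic to one whose underlying set consists of natural numbers, so
  the Grothendieck group is formed from pairs of such G-sets, a pair \<open>(A, B)\<close> standing for the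
  formal difference \<open>[A] - [B]\<close>. For finite G-sets \<open>X\<close>, \<open>Y\<close> over arbitrary types,
  \<open>burnside_diff G X Y\<close> is the equivalence class representing \<open>[X] - [Y]\<close>.
\<close>

type_synonym 'g burnside = "(('g, nat) gset \<times> ('g, nat) gset) set"

definition burnside_diff ::
    "('g, 'm) monoid_scheme \<Rightarrow> ('g, 'x) gset \<Rightarrow> ('g, 'y) gset \<Rightarrow> 'g burnside"
  where "burnside_diff G X Y =
    {(A, B). finite_gset G A \<and> finite_gset G B \<and>
       (\<exists>Z :: ('g, nat) gset. finite_gset G Z \<and>
          gset_iso G (gset_sum (gset_sum A Y) Z) (gset_sum (gset_sum B X) Z))}"

definition burnside_class :: "('g, 'm) monoid_scheme \<Rightarrow> ('g, 'x) gset \<Rightarrow> 'g burnside"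
  where "burnside_class G X = burnside_diff G X gset_empty"

definition burnside_ring :: "('g, 'm) monoid_scheme \<Rightarrow> 'g burnside ring"
  where "burnside_ring G =
    \<lparr>carrier = {burnside_diff G X Y | (X :: ('g, nat) gset) (Y :: ('g, nat) gset).
                  finite_gset G X \<and> finite_gset G Y},
     mult = (\<lambda>a b. \<Union>(X, Y)\<in>a. \<Union>(X', Y')\<in>b.
        burnside_diff G (gset_sum (gset_prod X X') (gset_prod Y Y'))
                        (gset_sum (gset_prod X Y') (gset_prod Y X'))),
     one = burnside_class G gset_point,
     zero = burnside_class G gset_empty,
     add = (\<lambda>a b. \<Union>(X, Y)\<in>a. \<Union>(X', Y')\<in>b.
        burnside_diff G (gset_sum X X') (gset_sum Y Y'))\<rparr>"

text \<open>The number \<open>|a\<^sup>H|\<close>; the expression does not depend on the representative of \<open>a\<close>.\<close>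

definition burnside_mark :: "'g set \<Rightarrow> 'g burnside \<Rightarrow> int"
  where "burnside_mark H a =
    the_elem ((\<lambda>(X, Y). int (card (gset_fixed X H)) - int (card (gset_fixed Y H))) ` a)"

definition maximal_subgroup :: "'g set \<Rightarrow> ('g, 'm) monoid_scheme \<Rightarrow> bool"
  where "maximal_subgroup M G \<longleftrightarrow>
    subgroup M G \<and> M \<noteq> carrier G \<and>
    (\<forall>K. subgroup K G \<and> M \<subseteq> K \<longrightarrow> K = M \<or> K = carrier G)"

definition burnside_v :: "('g, 'm) monoid_scheme \<Rightarrow> 'g set \<Rightarrow> 'g burnside"
  where "burnside_v S M =
    burnside_class S (gset_cosets S (carrier S))
      \<ominus>\<^bsub>burnside_ring S\<^esub> burnside_class S (gset_cosets S M)"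


section \<open>Fusion systems\<close>

definition conj_map :: "('g, 'm) monoid_scheme \<Rightarrow> 'g set \<Rightarrow> 'g \<Rightarrow> 'g \<Rightarrow> 'g"
  where "conj_map S P s = (\<lambda>x \<in> P. s \<otimes>\<^bsub>S\<^esub> x \<otimes>\<^bsub>S\<^esub> inv\<^bsub>S\<^esub> s)"

definition conj_hom :: "('g, 'm) monoid_scheme \<Rightarrow> 'g set \<Rightarrow> 'g set \<Rightarrow> ('g \<Rightarrow> 'g) set"
  where "conj_hom S P Q = {conj_map S P s | s. s \<in> carrier S \<and> conj_map S P s ` P \<subseteq> Q}"

text \<open>
  A category with the subgroups of \<open>S\<close> as objects is given by its family of morphism sets
  \<open>F P Q\<close>, whose elements are extensional functions, so that equality of morphisms is equality
  of functions. Only the values of \<open>F\<close> at subgroups of \<open>S\<close> are relevant.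
\<close>

type_synonym 'g hom_family = "'g set \<Rightarrow> 'g set \<Rightarrow> ('g \<Rightarrow> 'g) set"

definition F_iso :: "'g hom_family \<Rightarrow> 'g set \<Rightarrow> 'g set \<Rightarrow> ('g \<Rightarrow> 'g) set"
  where "F_iso F P Q =
    {\<phi> \<in> F P Q. \<exists>\<psi> \<in> F Q P. compose P \<psi> \<phi> = (\<lambda>x \<in> P. x) \<and> compose Q \<phi> \<psi> = (\<lambda>x \<in> Q. x)}"

text \<open>Identity morphisms belong to \<open>F\<close> by \<open>conj_hom_subset\<close>.\<close>

locale fusion_system = group S for S (structure) +
  fixes p :: nat and F :: "'a hom_family"
  assumes prime_p: "prime p"
    and p_group: "finite (carrier S)" "\<exists>n. order S = p ^ n"
    and F_morphism: "\<lbrakk>subgroup P S; subgroup Q S; \<phi> \<in> F P Q\<rbrakk> \<Longrightarrow>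
      \<phi> \<in> hom (S\<lparr>carrier := P\<rparr>) (S\<lparr>carrier := Q\<rparr>) \<and> inj_on \<phi> P \<and> \<phi> \<in> extensional P"
    and compose_closed: "\<lbrakk>subgroup P S; subgroup Q S; subgroup R S; \<phi> \<in> F P Q; \<psi> \<in> F Q R\<rbrakk> \<Longrightarrow>
      compose P \<psi> \<phi> \<in> F P R"
    and conj_hom_subset: "\<lbrakk>subgroup P S; subgroup Q S\<rbrakk> \<Longrightarrow> conj_hom S P Q \<subseteq> F P Q"
    and iso_inclusion: "\<lbrakk>subgroup P S; subgroup Q S; \<phi> \<in> F P Q\<rbrakk> \<Longrightarrow>
      \<exists>R \<psi>. subgroup R S \<and> R \<subseteq> Q \<and> \<psi> \<in> F_iso F P R \<and> \<phi> = compose P (\<lambda>x \<in> R. x) \<psi>"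

definition F_conj :: "'g hom_family \<Rightarrow> 'g set \<Rightarrow> 'g set \<Rightarrow> bool"
  where "F_conj F P Q \<longleftrightarrow> F_iso F P Q \<noteq> {}"

definition is_sylow :: "nat \<Rightarrow> 'a set \<Rightarrow> ('a, 'm) monoid_scheme \<Rightarrow> bool"
  where "is_sylow p H G \<longleftrightarrow> subgroup H G \<and> card H = p ^ multiplicity p (order G)"

definition fully_automized ::
    "('g, 'm) monoid_scheme \<Rightarrow> nat \<Rightarrow> 'g hom_family \<Rightarrow> 'g set \<Rightarrow> bool"
  where "fully_automized S p F P \<longleftrightarrow>
    is_sylow p (conj_hom S P P) (AutoGroup (S\<lparr>carrier := P\<rparr>)\<lparr>carrier := F P P\<rparr>)"

definition N_phi :: "('g, 'm) monoid_scheme \<Rightarrow> 'g set \<Rightarrow> 'g set \<Rightarrow> ('g \<Rightarrow> 'g) \<Rightarrow> 'g set"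
  where "N_phi S Q P \<phi> =
    {g \<in> normalizer S Q.
       compose P \<phi> (compose P (conj_map S Q g) (\<lambda>x \<in> P. inv_into Q \<phi> x)) \<in> conj_hom S P P}"

definition receptive :: "('g, 'm) monoid_scheme \<Rightarrow> 'g hom_family \<Rightarrow> 'g set \<Rightarrow> bool"
  where "receptive S F P \<longleftrightarrow>
    (\<forall>Q \<phi>. subgroup Q S \<and> \<phi> \<in> F_iso F Q P \<longrightarrow>
       (\<exists>R \<psi>. subgroup R S \<and> \<psi> \<in> F (N_phi S Q P \<phi>) R \<and> (\<forall>x\<in>Q. \<psi> x = \<phi> x)))"

locale saturated_fusion_system = fusion_system +
  assumes saturated: "subgroup P S \<Longrightarrow>
    \<exists>Q. subgroup Q S \<and> F_conj F P Q \<and> fully_automized S p F Q \<and> receptive S F Q"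

definition F_class :: "('g, 'm) monoid_scheme \<Rightarrow> 'g hom_family \<Rightarrow> 'g \<Rightarrow> 'g set"
  where "F_class S F x =
    {y \<in> carrier S. \<exists>\<phi> \<in> F_iso F (generate S {x}) (generate S {y}). \<phi> x = y}"

definition strongly_closed :: "('g, 'm) monoid_scheme \<Rightarrow> 'g hom_family \<Rightarrow> 'g set \<Rightarrow> bool"
  where "strongly_closed S F P \<longleftrightarrow> subgroup P S \<and> (\<forall>x\<in>P. F_class S F x \<subseteq> P)"

definition fusion_burnside_ring ::
    "('g, 'm) monoid_scheme \<Rightarrow> 'g hom_family \<Rightarrow> 'g burnside ring"
  where "fusion_burnside_ring S F = burnside_ring S
    \<lparr>carrier := {a \<in> carrier (burnside_ring S). \<forall>P Q.
       subgroup P S \<and> subgroup Q S \<and> F_conj F P Q \<longrightarrow> burnside_mark P a = burnside_mark Q a}\<rparr>"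

end

theory Submission
  imports Defs "HOL-Number_Theory.Cong" "HOL-Algebra.Sylow"
begin

text \<open>
  Burnside's theorem says that two finite G-sets are isomorphic as soon as their marks agree on all
  subgroups: a point with a stabilizer that is maximal among all stabilizers in one G-set forces a
  point with the same stabilizer in the other, so that a common orbit can be split off. Hence
  computations in the Burnside ring reduce to integer arithmetic with marks. A maximal subgroup
  \<open>M\<close> of a 2-group is normal of index 2, which gives the marks \<open>\<plusminus>1\<close> of \<open>v\<^sub>M\<close> and
  \<open>v\<^sub>M\<^sup>2 = 1\<close>. Thus \<open>v\<^sub>M\<close> is a unit of the Burnside ring of \<open>F\<close> iff containment in \<open>M\<close> is
  invariant under F-conjugacy of subgroups, and restricting isomorphisms in \<open>F\<close> to cyclic
  subgroups identifies this with strong closure.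
\<close>

section \<open>Group actions and fixed points\<close>

text \<open>Bijectivity comes for free, because \<open>\<phi> (inv g)\<close> is a two-sided inverse
  of \<open>\<phi> g\<close>. Extensionality is required since the elements of \<open>Bij E\<close>
  are extensional functions.\<close>

lemma group_actionI:
  assumes "group G"
    and ext: "\<And>g. g \<in> carrier G \<Longrightarrow> \<phi> g \<in> extensional E"
    and closed: "\<And>g x. \<lbrakk>g \<in> carrier G; x \<in> E\<rbrakk> \<Longrightarrow> \<phi> g x \<in> E"
    and one: "\<And>x. x \<in> E \<Longrightarrow> \<phi> \<one>\<^bsub>G\<^esub> x = x"
    and mult: "\<And>g h x. \<lbrakk>g \<in> carrier G; h \<in> carrier G; x \<in> E\<rbrakk> \<Longrightarrow> \<phi> (g \<otimes>\<^bsub>G\<^esub> h) x = \<phi> g (\<phi> h x)"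
  shows "group_action G E \<phi>"
proof -
  interpret group G by fact
  have inv: "\<phi> g (\<phi> (inv\<^bsub>G\<^esub> g) x) = x" "\<phi> (inv\<^bsub>G\<^esub> g) (\<phi> g x) = x" if "g \<in> carrier G" "x \<in> E" for g x
    using mult[of g "inv\<^bsub>G\<^esub> g" x] mult[of "inv\<^bsub>G\<^esub> g" g x] one that by auto
  have bij: "\<phi> g \<in> Bij E" if "g \<in> carrier G" for g
    unfolding Bij_def using ext[OF that] that closed inv
    by (auto intro!: bij_betw_byWitness[where f' = "\<phi> (inv\<^bsub>G\<^esub> g)"])
  have "\<phi> (g \<otimes>\<^bsub>G\<^esub> h) = compose E (\<phi> g) (\<phi> h)" if "g \<in> carrier G" "h \<in> carrier G" for g h
    by (rule extensionalityI[where A = E]) (auto simp: ext that compose_eq mult)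
  then have "\<phi> \<in> hom G (BijGroup E)"
    using bij by (auto simp: hom_def BijGroup_def)
  then show ?thesis
    by (simp add: group_action_def group_hom_def group_hom_axioms_def group_BijGroup is_group)
qed

lemma finite_gsetI:
  assumes "group G" "finite (fst X)"
    and "\<And>g. g \<in> carrier G \<Longrightarrow> snd X g \<in> extensional (fst X)"
    and "\<And>g x. \<lbrakk>g \<in> carrier G; x \<in> fst X\<rbrakk> \<Longrightarrow> snd X g x \<in> fst X"
    and "\<And>x. x \<in> fst X \<Longrightarrow> snd X \<one>\<^bsub>G\<^esub> x = x"
    and "\<And>g h x. \<lbrakk>g \<in> carrier G; h \<in> carrier G; x \<in> fst X\<rbrakk>
      \<Longrightarrow> snd X (g \<otimes>\<^bsub>G\<^esub> h) x = snd X g (snd X h x)"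
  shows "finite_gset G X"
  using assms by (simp add: finite_gset_def group_actionI)

text \<open>An equivariant bijection matches fixed points with fixed points. The form with plain
  functions on invariant sets serves for single orbits as well as for whole G-sets.\<close>

lemma card_fixed_eq:
  assumes f: "bij_betw f A B"
    and equiv: "\<And>g x. \<lbrakk>g \<in> carrier G; x \<in> A\<rbrakk> \<Longrightarrow> f (\<phi> g x) = \<psi> g (f x)"
    and closed: "\<And>g x. \<lbrakk>g \<in> carrier G; x \<in> A\<rbrakk> \<Longrightarrow> \<phi> g x \<in> A"
    and H: "H \<subseteq> carrier G"
  shows "card {x \<in> A. \<forall>h\<in>H. \<phi> h x = x} = card {y \<in> B. \<forall>h\<in>H. \<psi> h y = y}"
proof (rule bij_betw_same_card)
  have "\<phi> h x = x \<longleftrightarrow> \<psi> h (f x) = f x" if "h \<in> H" "x \<in> A" for h x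
    using equiv[of h x] closed[of h x] that H f by (metis bij_betw_inv_into_left subsetD)
  then have "f ` {x \<in> A. \<forall>h\<in>H. \<phi> h x = x} = {y \<in> B. \<forall>h\<in>H. \<psi> h y = y}"
    using f by (force simp: bij_betw_def)
  then show "bij_betw f {x \<in> A. \<forall>h\<in>H. \<phi> h x = x} {y \<in> B. \<forall>h\<in>H. \<psi> h y = y}"
    by (rule bij_betw_subset[OF f, rotated]) auto
qed

section \<open>Orbits, stabilizers and Burnside's theorem\<close>

lemma (in group_action) image_eq_iff_stabilizer:
  assumes "x \<in> E" "g \<in> carrier G" "h \<in> carrier G"
  shows "\<phi> g x = \<phi> h x \<longleftrightarrow> inv h \<otimes> g \<in> stabilizer G \<phi> x"
proof -
  interpret group G using group_hom group_hom.axioms(1) by auto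
  have "\<phi> (inv h \<otimes> g) x = x \<longleftrightarrow> \<phi> g x = \<phi> h x"
    using assms composition_rule orbit_sym_aux by (metis element_image inv_closed inv_inv)
  then show ?thesis using assms by (auto simp: stabilizer_def)
qed

text \<open>The equivalence makes both an orbit and its complement invariant, which is what removing
  an orbit requires.\<close>

lemma (in group_action) orbit_closed:
  assumes "x \<in> E" "g \<in> carrier G" "z \<in> E"
  shows "\<phi> g z \<in> orbit G \<phi> x \<longleftrightarrow> z \<in> orbit G \<phi> x"
proof -
  have "\<phi> g z \<in> orbit G \<phi> z" "\<phi> g z \<in> E" using assms element_image by (auto simp: orbit_def)
  then show ?thesis using orbit_trans orbit_sym assms by meson
qed

text \<open>Both orbits are copies of the cosets of the common stabilizer; the bijection sends
  \<open>\<phi> g x\<close> to \<open>\<psi> g y\<close>.\<close>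

lemma orbits_bij:
  fixes G (structure)
  assumes "group_action G E \<phi>" "group_action G E' \<psi>" and x: "x \<in> E" and y: "y \<in> E'"
    and stab: "stabilizer G \<phi> x = stabilizer G \<psi> y"
  obtains f where "bij_betw f (orbit G \<phi> x) (orbit G \<psi> y)"
    "\<And>g z. \<lbrakk>g \<in> carrier G; z \<in> orbit G \<phi> x\<rbrakk> \<Longrightarrow> f (\<phi> g z) = \<psi> g (f z)"
proof -
  interpret A: group_action G E \<phi> by fact
  interpret B: group_action G E' \<psi> by fact
  interpret group G using A.group_hom group_hom.axioms(1) by auto
  \<comment> \<open>Any group element carrying \<open>x\<close> to \<open>z\<close> may be chosen:
    \<open>same\<close> shows that the value does not depend on the choice, since equal stabilizers
    identify the same group elements on both sides.\<close>
  define f where "f z = \<psi> (SOME g. g \<in> carrier G \<and> \<phi> g x = z) y" for z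
  have same: "\<phi> g x = \<phi> h x \<longleftrightarrow> \<psi> g y = \<psi> h y" if "g \<in> carrier G" "h \<in> carrier G" for g h
    using that by (simp add: A.image_eq_iff_stabilizer x B.image_eq_iff_stabilizer y stab)
  have f: "f (\<phi> g x) = \<psi> g y" if "g \<in> carrier G" for g
  proof -
    let ?h = "SOME h. h \<in> carrier G \<and> \<phi> h x = \<phi> g x"
    have "?h \<in> carrier G \<and> \<phi> ?h x = \<phi> g x" by (rule someI[of _ g]) (simp add: that)
    then show ?thesis unfolding f_def using same[of ?h g] that by blast
  qed
  show thesis
  proof
    show "bij_betw f (orbit G \<phi> x) (orbit G \<psi> y)"
      unfolding bij_betw_def inj_on_def orbit_def using f same by force
    show "f (\<phi> g z) = \<psi> g (f z)" if g: "g \<in> carrier G" and "z \<in> orbit G \<phi> x" for g z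
    proof -
      obtain h where h: "h \<in> carrier G" "z = \<phi> h x" using \<open>z \<in> _\<close> by (auto simp: orbit_def)
      then show ?thesis
        using f[of "g \<otimes> h"] f[of h] g x y by (simp add: A.composition_rule B.composition_rule)
    qed
  qed
qed

text \<open>Induction on the size of \<open>A\<close>, splitting off one orbit on each side. The
  sets \<open>A\<close> and \<open>B\<close> vary inside fixed G-sets \<open>E\<close> and
  \<open>E'\<close>, so the complement of an orbit needs no action of its own.\<close>

lemma equal_marks_imp_bij:
  fixes G (structure)
  assumes "group_action G E \<phi>" "group_action G E' \<psi>"
  shows "\<lbrakk>finite A; finite B; A \<subseteq> E; B \<subseteq> E';
    \<And>g x. \<lbrakk>g \<in> carrier G; x \<in> A\<rbrakk> \<Longrightarrow> \<phi> g x \<in> A;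
    \<And>g y. \<lbrakk>g \<in> carrier G; y \<in> B\<rbrakk> \<Longrightarrow> \<psi> g y \<in> B;
    \<And>H. subgroup H G \<Longrightarrow>
      card {x \<in> A. \<forall>h\<in>H. \<phi> h x = x} = card {y \<in> B. \<forall>h\<in>H. \<psi> h y = y}\<rbrakk>
   \<Longrightarrow> \<exists>f. bij_betw f A B \<and> (\<forall>g\<in>carrier G. \<forall>x\<in>A. f (\<phi> g x) = \<psi> g (f x))"
proof (induction "card A" arbitrary: A B rule: less_induct)
  case less
  interpret A: group_action G E \<phi> by fact
  interpret B: group_action G E' \<psi> by fact
  interpret group G using A.group_hom group_hom.axioms(1) by auto
  note A = \<open>finite A\<close> \<open>A \<subseteq> E\<close> less.prems(5) and B = \<open>finite B\<close> \<open>B \<subseteq> E'\<close> less.prems(6)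
    and marks = less.prems(7)
  have B_one: "\<psi> \<one> y = y" if "y \<in> B" for y
    using B.id_eq_one B(2) that by (metis restrict_apply' subsetD)
  show ?case
  proof (cases "A = {}")
    case True
    \<comment> \<open>The trivial subgroup fixes every point, so its mark is the
      cardinality.\<close>
    then have "{y \<in> B. \<forall>h\<in>{\<one>}. \<psi> h y = y} = {}"
      using marks[OF triv_subgroup] B(1) by simp
    then have "B = {}" using B_one by auto
    then show ?thesis using True by (simp add: bij_betw_def)
  next
    case False
    then obtain x where x: "x \<in> A"
      and max: "\<And>x'. \<lbrakk>x' \<in> A; stabilizer G \<phi> x \<subseteq> stabilizer G \<phi> x'\<rbrakk>
        \<Longrightarrow> stabilizer G \<phi> x = stabilizer G \<phi> x'"
      using finite_has_maximal[of "stabilizer G \<phi> ` A"] A(1) by auto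
    have xE: "x \<in> E" using x A by auto
    let ?H = "stabilizer G \<phi> x"
    have H: "subgroup ?H G" using A.stabilizer_subgroup xE .
    \<comment> \<open>The point \<open>x\<close> is counted by the mark at its own stabilizer
      \<open>?H\<close>, so \<open>?H\<close> also fixes some \<open>y\<close> in
      \<open>B\<close>.\<close>
    have "x \<in> {x \<in> A. \<forall>h\<in>?H. \<phi> h x = x}" using x by (auto simp: stabilizer_def)
    then have "card {x \<in> A. \<forall>h\<in>?H. \<phi> h x = x} > 0" using A(1) by (auto simp: card_gt_0_iff)
    then have "card {y \<in> B. \<forall>h\<in>?H. \<psi> h y = y} > 0" using marks[OF H] by simp
    then obtain y where y: "y \<in> B" "\<forall>h\<in>?H. \<psi> h y = y" by (auto simp: card_gt_0_iff)
    have yE: "y \<in> E'" using y B by auto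
    let ?K = "stabilizer G \<psi> y"
    have HK: "?H \<subseteq> ?K" using y by (auto simp: stabilizer_def)
    have K: "subgroup ?K G" using B.stabilizer_subgroup yE .
    \<comment> \<open>The same argument backwards: \<open>?K\<close> fixes some \<open>x'\<close> in
      \<open>A\<close>, and the maximality of \<open>?H\<close> collapses the chain of stabilizers
      \<open>?H \<subseteq> ?K \<subseteq> stabilizer G \<phi> x'\<close>.\<close>
    have "y \<in> {y \<in> B. \<forall>h\<in>?K. \<psi> h y = y}" using y by (auto simp: stabilizer_def)
    then have "card {y \<in> B. \<forall>h\<in>?K. \<psi> h y = y} > 0" using B(1) by (auto simp: card_gt_0_iff)
    then have "card {x \<in> A. \<forall>h\<in>?K. \<phi> h x = x} > 0" using marks[OF K] by simp
    then obtain x' where x': "x' \<in> A" "\<forall>h\<in>?K. \<phi> h x' = x'" by (auto simp: card_gt_0_iff)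
    have "?K \<subseteq> stabilizer G \<phi> x'" using x' by (auto simp: stabilizer_def)
    then have stab: "?H = ?K" using max[OF x'(1)] HK by auto
    let ?O = "orbit G \<phi> x" and ?P = "orbit G \<psi> y"
    obtain f where f: "bij_betw f ?O ?P"
      and feq: "\<And>g z. \<lbrakk>g \<in> carrier G; z \<in> ?O\<rbrakk> \<Longrightarrow> f (\<phi> g z) = \<psi> g (f z)"
      using orbits_bij[OF assms xE yE stab] by blast
    have O: "?O \<subseteq> A" "x \<in> ?O" and P: "?P \<subseteq> B"
      using A(3) x B(3) y A.orbit_refl xE by (auto simp: orbit_def)
    have closed: "\<phi> g z \<in> A - ?O \<longleftrightarrow> z \<notin> ?O" if "g \<in> carrier G" "z \<in> A" for g z
      using A.orbit_closed[OF xE that(1), of z] A(2) A(3)[OF that] that by auto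
    have closed': "\<psi> g z \<in> B - ?P \<longleftrightarrow> z \<notin> ?P" if "g \<in> carrier G" "z \<in> B" for g z
      using B.orbit_closed[OF yE that(1), of z] B(2) B(3)[OF that] that by auto
    \<comment> \<open>The orbits have equal marks through \<open>f\<close>; subtracting them leaves
      equal marks on the complements.\<close>
    have marks': "card {x \<in> A - ?O. \<forall>h\<in>H. \<phi> h x = x} = card {y \<in> B - ?P. \<forall>h\<in>H. \<psi> h y = y}"
      if "subgroup H G" for H
    proof -
      have "card {z \<in> ?O. \<forall>h\<in>H. \<phi> h z = z} = card {z \<in> ?P. \<forall>h\<in>H. \<psi> h z = z}"
      proof (rule card_fixed_eq[where G = G and \<phi> = \<phi> and \<psi> = \<psi>, OF f feq _ subgroup.subset[OF that]])
        show "\<phi> g z \<in> ?O" if "g \<in> carrier G" "z \<in> ?O" for g z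
          using A.orbit_closed[OF xE that(1)] that O(1) A(2) by blast
      qed
      moreover have "{x \<in> A - ?O. \<forall>h\<in>H. \<phi> h x = x}
          = {x \<in> A. \<forall>h\<in>H. \<phi> h x = x} - {z \<in> ?O. \<forall>h\<in>H. \<phi> h z = z}"
        "{x \<in> B - ?P. \<forall>h\<in>H. \<psi> h x = x}
          = {x \<in> B. \<forall>h\<in>H. \<psi> h x = x} - {z \<in> ?P. \<forall>h\<in>H. \<psi> h z = z}" by auto
      moreover have "{z \<in> ?O. \<forall>h\<in>H. \<phi> h z = z} \<subseteq> {x \<in> A. \<forall>h\<in>H. \<phi> h x = x}"
        "{z \<in> ?P. \<forall>h\<in>H. \<psi> h z = z} \<subseteq> {x \<in> B. \<forall>h\<in>H. \<psi> h x = x}" using O P by auto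
      ultimately show ?thesis
        using A(1) B(1) O P marks[OF that]
        by (simp add: card_Diff_subset finite_subset[OF O(1)] finite_subset[OF P])
    qed
    have "\<exists>f. bij_betw f (A - ?O) (B - ?P)
        \<and> (\<forall>g\<in>carrier G. \<forall>x\<in>A - ?O. f (\<phi> g x) = \<psi> g (f x))"
    proof (rule less.hyps[OF _ _ _ _ _ _ _ marks'])
      show "card (A - ?O) < card A" using A(1) O x by (intro psubset_card_mono) auto
    qed (use A(1,2) B(1,2) closed closed' in auto)
    then obtain f' where f': "bij_betw f' (A - ?O) (B - ?P)"
      and feq': "\<And>g z. \<lbrakk>g \<in> carrier G; z \<in> A - ?O\<rbrakk> \<Longrightarrow> f' (\<phi> g z) = \<psi> g (f' z)" by blast
    let ?f = "\<lambda>z. if z \<in> ?O then f z else f' z"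
    have "bij_betw ?f (?O \<union> (A - ?O)) (?P \<union> (B - ?P))"
      by (rule bij_betw_disjoint_Un[OF f f']) auto
    moreover have "?O \<union> (A - ?O) = A" "?P \<union> (B - ?P) = B" using O P by auto
    moreover have "?f (\<phi> g z) = \<psi> g (?f z)" if "g \<in> carrier G" "z \<in> A" for g z
      using closed[OF that] feq feq' that A(3)[OF that] by auto
    ultimately show ?thesis by auto
  qed
qed

text \<open>The size of an orbit divides a power of \<open>p\<close>, so every orbit with more than
  one point contributes a multiple of \<open>p\<close>.\<close>

lemma (in group_action) card_fixed_cong:
  assumes "prime p" "order G = p ^ n" "finite E"
  shows "[card E = card {x \<in> E. \<forall>g\<in>carrier G. \<phi> g x = x}] (mod p)"
proof -
  let ?fix = "\<lambda>x. \<forall>g\<in>carrier G. \<phi> g x = x"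
  have orb: "[(\<Sum>x\<in>b. 1) = (\<Sum>x\<in>b. if ?fix x then 1 else 0)] (mod p)" if "b \<in> orbits G E \<phi>" for b
  proof -
    obtain x where x: "x \<in> E" "b = orbit G \<phi> x" using \<open>b \<in> _\<close> by (auto simp: orbits_def)
    have xb: "x \<in> b" using x orbit_refl by simp
    show ?thesis
    proof (cases "?fix x")
      case True
      then have "b = {x}" using x xb by (auto simp: orbit_def)
      then show ?thesis using True by simp
    next
      case False
      \<comment> \<open>A fixed point is alone in its orbit, so it would have to coincide with
        \<open>x\<close>.\<close>
      have nofix: "\<not> ?fix z" if "z \<in> b" for z
      proof
        assume "?fix z"
        moreover have "z \<in> E" using that x element_image by (auto simp: orbit_def)
        ultimately have "x = z" using orbit_sym[OF x(1), of z] that x by (auto simp: orbit_def)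
        then show False using \<open>?fix z\<close> False by simp
      qed
      have "card b dvd p ^ n"
        using orbit_stabilizer_theorem[OF x(1)] x(2) assms(2) by (metis dvd_triv_left)
      then obtain k where k: "card b = p ^ k" using assms(1) by (meson divides_primepow_nat)
      obtain g where g: "g \<in> carrier G" "\<phi> g x \<noteq> x" using False by blast
      then have "\<phi> g x \<in> b" using x(2) by (auto simp: orbit_def)
      then have "card b \<noteq> 1" using xb g(2) by (auto simp: card_1_singleton_iff)
      then have "p dvd card b" using k by (cases k) auto
      moreover have "(\<Sum>x\<in>b. if ?fix x then 1 else 0) = (0::nat)"
        using nofix by (intro sum.neutral) auto
      ultimately show ?thesis by (simp add: cong_0_iff)
    qed
  qed
  \<comment> \<open>Both cardinalities are decomposed over the orbits, the second as a sum of
    indicators of fixed points.\<close>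
  have "[(\<Sum>b\<in>orbits G E \<phi>. \<Sum>x\<in>b. 1) = (\<Sum>b\<in>orbits G E \<phi>. \<Sum>x\<in>b. if ?fix x then 1 else 0)] (mod p)"
    by (intro cong_sum orb)
  then show ?thesis
    unfolding disjoint_sum[OF assms(3)] card_as_sums[OF refl assms(3)] by simp
qed


section \<open>Marks and the Burnside ring\<close>

lemma finite_gsetD:
  assumes "finite_gset G X"
  shows "group_action G (fst X) (snd X)" "finite (fst X)" "group G"
    "\<And>g x. \<lbrakk>g \<in> carrier G; x \<in> fst X\<rbrakk> \<Longrightarrow> snd X g x \<in> fst X"
    "\<And>x. x \<in> fst X \<Longrightarrow> snd X \<one>\<^bsub>G\<^esub> x = x"
    "\<And>g h x. \<lbrakk>g \<in> carrier G; h \<in> carrier G; x \<in> fst X\<rbrakk>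
      \<Longrightarrow> snd X (g \<otimes>\<^bsub>G\<^esub> h) x = snd X g (snd X h x)"
proof -
  show *: "group_action G (fst X) (snd X)" and "finite (fst X)"
    using assms by (simp_all add: finite_gset_def)
  interpret group_action G "fst X" "snd X" by fact
  show "group G" using group_hom group_hom.axioms(1) by auto
  show "snd X g x \<in> fst X" if "g \<in> carrier G" "x \<in> fst X" for g x
    using element_image that by blast
  show "snd X \<one>\<^bsub>G\<^esub> x = x" if "x \<in> fst X" for x
    using id_eq_one that by (metis restrict_apply')
  show "snd X (g \<otimes>\<^bsub>G\<^esub> h) x = snd X g (snd X h x)"
    if "g \<in> carrier G" "h \<in> carrier G" "x \<in> fst X" for g h x
    using composition_rule that by simp
qed

lemma finite_gset_sum [intro]:
  assumes "finite_gset G X" "finite_gset G Y"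
  shows "finite_gset G (gset_sum X Y)"
  using finite_gsetD[OF assms(1)] finite_gsetD[OF assms(2)]
  by (intro finite_gsetI) (auto simp: gset_sum_def group.is_monoid monoid.m_closed)

lemma finite_gset_prod [intro]:
  assumes "finite_gset G X" "finite_gset G Y"
  shows "finite_gset G (gset_prod X Y)"
  using finite_gsetD[OF assms(1)] finite_gsetD[OF assms(2)]
  by (intro finite_gsetI) (auto simp: gset_prod_def group.is_monoid monoid.m_closed)

lemma finite_gset_empty [intro]: "group G \<Longrightarrow> finite_gset G gset_empty"
  by (intro finite_gsetI) (auto simp: gset_empty_def)

lemma finite_gset_point [intro]: "group G \<Longrightarrow> finite_gset G gset_point"
  by (intro finite_gsetI) (auto simp: gset_point_def)

lemma finite_gset_cosets [intro]:
  assumes "group G" "finite (carrier G)" "subgroup H G"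
  shows "finite_gset G (gset_cosets G H)"
proof -
  interpret group G by fact
  have H: "H \<subseteq> carrier G" using assms(3) subgroup.subset by blast
  have "finite (lcosets\<^bsub>G\<^esub> H)" using assms(2) by (simp add: LCOSETS_def)
  moreover have "g <#\<^bsub>G\<^esub> C \<in> lcosets\<^bsub>G\<^esub> H" if "g \<in> carrier G" "C \<in> lcosets\<^bsub>G\<^esub> H" for g C
    using that H by (auto simp: LCOSETS_def lcos_m_assoc intro!: bexI[of _ "g \<otimes>\<^bsub>G\<^esub> _"])
  moreover have "C \<subseteq> carrier G" if "C \<in> lcosets\<^bsub>G\<^esub> H" for C
    using that lcosets_subset_PowG[OF assms(3)] by auto
  ultimately show ?thesis
    by (intro finite_gsetI) (auto simp: gset_cosets_def lcos_m_assoc lcos_mult_one assms(1))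
qed

text \<open>The action is transported along an enumeration of the points. This links G-sets over
  other types, such as coset spaces, with the representatives on \<open>nat\<close> that make up a
  class.\<close>

lemma gset_nat_copy:
  fixes X :: "('g, 'x) gset"
  assumes X: "finite_gset G X"
  obtains Y :: "('g, nat) gset" where "finite_gset G Y" "gset_iso G X Y"
proof -
  note X = finite_gsetD[OF X]
  obtain e where e: "bij_betw e (fst X) {0..<card (fst X)}" using ex_bij_betw_finite_nat[OF X(2)] by blast
  let ?I = "{0..<card (fst X)}" and ?d = "inv_into (fst X) e"
  have d: "?d i \<in> fst X" "e (?d i) = i" if "i \<in> ?I" for i
    using e that by (metis bij_betw_def inv_into_into, metis bij_betw_def f_inv_into_f)
  have ed: "?d (e x) = x" "e x \<in> ?I" if "x \<in> fst X" for x
    using e that by (simp_all add: bij_betw_inv_into_left bij_betw_apply del: atLeastLessThan_iff)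
  define Y :: "('g, nat) gset" where "Y = (?I, \<lambda>g. \<lambda>i\<in>?I. e (snd X g (?d i)))"
  have "finite_gset G Y"
    using X d ed
    by (intro finite_gsetI) (simp_all add: Y_def del: atLeastLessThan_iff)
  moreover have "gset_iso G X Y"
    unfolding gset_iso_def Y_def using e d ed by (auto intro!: exI[of _ e] simp del: atLeastLessThan_iff)
  ultimately show thesis by (rule that)
qed

text \<open>Integer-valued, so that formal differences can be compared by subtraction.\<close>

definition gset_mark :: "('g, 'x) gset \<Rightarrow> 'g set \<Rightarrow> int"
  where "gset_mark X H = int (card (gset_fixed X H))"

section \<open>Marks of sums and products\<close>

lemma finite_fst_gset_sum_prod [simp]:
  assumes "finite (fst X)" "finite (fst Y)"
  shows "finite (fst (gset_sum X Y))" "finite (fst (gset_prod X Y))"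
  using assms by (simp_all add: gset_sum_def gset_prod_def)

lemma gset_mark_sum:
  assumes "finite (fst X)" "finite (fst Y)"
  shows "gset_mark (gset_sum X Y) H = gset_mark X H + gset_mark Y H"
proof -
  have "gset_fixed (gset_sum X Y) H = gset_fixed X H <+> gset_fixed Y H"
    by (auto simp: gset_fixed_def gset_sum_def)
  moreover have "finite (gset_fixed X H)" "finite (gset_fixed Y H)"
    using assms by (simp_all add: gset_fixed_def)
  ultimately show ?thesis by (simp add: gset_mark_def card_Plus)
qed

lemma gset_mark_prod: "gset_mark (gset_prod X Y) H = gset_mark X H * gset_mark Y H"
proof -
  have "gset_fixed (gset_prod X Y) H = gset_fixed X H \<times> gset_fixed Y H"
    by (auto simp: gset_fixed_def gset_prod_def)
  then show ?thesis by (simp add: gset_mark_def card_cartesian_product)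
qed

lemma gset_mark_empty [simp]: "gset_mark gset_empty H = 0"
  by (simp add: gset_mark_def gset_fixed_def gset_empty_def)

lemma gset_mark_point [simp]: "gset_mark gset_point H = 1"
proof -
  have "gset_fixed gset_point H = {0}" by (auto simp: gset_fixed_def gset_point_def)
  then show ?thesis by (simp add: gset_mark_def)
qed

text \<open>Burnside's theorem: fixed points are carried along an isomorphism, and the converse is
  \<open>equal_marks_imp_bij\<close> applied to the whole G-sets.\<close>

theorem gset_iso_iff_marks:
  assumes X: "finite_gset G X" and Y: "finite_gset G Y"
  shows "gset_iso G X Y \<longleftrightarrow> (\<forall>H. subgroup H G \<longrightarrow> gset_mark X H = gset_mark Y H)"
proof
  assume "gset_iso G X Y"
  then obtain f where f: "bij_betw f (fst X) (fst Y)"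
    and equiv: "\<And>g x. \<lbrakk>g \<in> carrier G; x \<in> fst X\<rbrakk> \<Longrightarrow> f (snd X g x) = snd Y g (f x)"
    by (auto simp: gset_iso_def)
  have "card (gset_fixed X H) = card (gset_fixed Y H)" if "subgroup H G" for H
    unfolding gset_fixed_def using finite_gsetD[OF X]
    by (intro card_fixed_eq[where G = G and \<phi> = "snd X" and \<psi> = "snd Y", OF f equiv _ subgroup.subset[OF that]])
  then show "\<forall>H. subgroup H G \<longrightarrow> gset_mark X H = gset_mark Y H"
    by (simp add: gset_mark_def)
next
  assume "\<forall>H. subgroup H G \<longrightarrow> gset_mark X H = gset_mark Y H"
  then show "gset_iso G X Y"
    unfolding gset_iso_def using finite_gsetD[OF X] finite_gsetD[OF Y]
    by (intro equal_marks_imp_bij[where E = "fst X" and E' = "fst Y" and G = G])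
      (auto simp: gset_mark_def gset_fixed_def)
qed

text \<open>Burnside's theorem turns the isomorphism into an equation of marks, from which the
  contribution of \<open>Z\<close> cancels. Conversely, the empty G-set can serve as
  \<open>Z\<close>.\<close>

lemma burnside_diff_eq:
  assumes X: "finite_gset G X" and Y: "finite_gset G Y"
  shows "burnside_diff G X Y = {(A, B). finite_gset G A \<and> finite_gset G B \<and>
    (\<forall>H. subgroup H G \<longrightarrow> gset_mark A H - gset_mark B H = gset_mark X H - gset_mark Y H)}"
proof -
  have "(\<exists>Z :: ('a, nat) gset. finite_gset G Z \<and>
        gset_iso G (gset_sum (gset_sum A Y) Z) (gset_sum (gset_sum B X) Z)) \<longleftrightarrow>
      (\<forall>H. subgroup H G \<longrightarrow> gset_mark A H - gset_mark B H = gset_mark X H - gset_mark Y H)"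
    if AB: "finite_gset G A" "finite_gset G B" for A B :: "('a, nat) gset"
  proof -
    have "gset_iso G (gset_sum (gset_sum A Y) Z) (gset_sum (gset_sum B X) Z) \<longleftrightarrow>
      (\<forall>H. subgroup H G \<longrightarrow> gset_mark A H - gset_mark B H = gset_mark X H - gset_mark Y H)"
      if Z: "finite_gset G Z" for Z :: "('a, nat) gset"
    proof -
      have fin: "finite (fst A)" "finite (fst B)" "finite (fst X)" "finite (fst Y)" "finite (fst Z)"
        using X Y AB Z by (simp_all add: finite_gset_def)
      have sum: "finite_gset G (gset_sum A Y)" "finite_gset G (gset_sum B X)"
        "finite_gset G (gset_sum (gset_sum A Y) Z)" "finite_gset G (gset_sum (gset_sum B X) Z)"
        using X Y AB Z by auto
      show ?thesis
        unfolding gset_iso_iff_marks[OF sum(3,4)]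
        by (simp add: gset_mark_sum fin sum[THEN finite_gsetD(2)] algebra_simps)
    qed
    then show ?thesis using finite_gset_empty[OF finite_gsetD(3)[OF X]] by blast
  qed
  then show ?thesis unfolding burnside_diff_def by blast
qed

lemma burnside_diff_cong:
  assumes "finite_gset G X" "finite_gset G Y" "finite_gset G X'" "finite_gset G Y'"
    and "\<And>H. subgroup H G \<Longrightarrow> gset_mark X H - gset_mark Y H = gset_mark X' H - gset_mark Y' H"
  shows "burnside_diff G X Y = burnside_diff G X' Y'"
  using assms by (auto simp: burnside_diff_eq)

text \<open>Copies on \<open>nat\<close> represent differences of G-sets over any types. They show
  that such a difference lies in the carrier and is a nonempty class.\<close>

lemma burnside_diff_nat:
  fixes X :: "('g, 'x) gset" and Y :: "('g, 'y) gset"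
  assumes X: "finite_gset G X" and Y: "finite_gset G Y"
  obtains A B :: "('g, nat) gset" where "(A, B) \<in> burnside_diff G X Y"
    "finite_gset G A" "finite_gset G B" "burnside_diff G A B = burnside_diff G X Y"
proof -
  obtain A B :: "('g, nat) gset" where A: "finite_gset G A" "gset_iso G X A"
    and B: "finite_gset G B" "gset_iso G Y B"
    using gset_nat_copy X Y by metis
  then have marks: "gset_mark A H - gset_mark B H = gset_mark X H - gset_mark Y H"
    if "subgroup H G" for H
    using X Y that by (simp add: gset_iso_iff_marks)
  show thesis
  proof
    show "(A, B) \<in> burnside_diff G X Y" using X Y A B marks by (simp add: burnside_diff_eq)
    show "burnside_diff G A B = burnside_diff G X Y"
      using X Y A B marks by (intro burnside_diff_cong)
  qed (use A B in auto)
qed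

lemma burnside_diff_closed:
  assumes "finite_gset G X" "finite_gset G Y"
  shows "burnside_diff G X Y \<in> carrier (burnside_ring G)"
proof -
  obtain A B :: "('a, nat) gset" where "finite_gset G A" "finite_gset G B"
    "burnside_diff G X Y = burnside_diff G A B"
    using burnside_diff_nat[OF assms] by metis
  then show ?thesis unfolding burnside_ring_def partial_object.select_convs by blast
qed

lemma burnside_carrierE:
  assumes "a \<in> carrier (burnside_ring G)"
  obtains X Y :: "('g, nat) gset"
  where "finite_gset G X" "finite_gset G Y" "a = burnside_diff G X Y"
  using assms by (auto simp: burnside_ring_def)

lemma burnside_diff_nonempty:
  assumes "finite_gset G X" "finite_gset G Y"
  shows "burnside_diff G X Y \<noteq> {}"
  using burnside_diff_nat[OF assms] by (metis empty_iff)

text \<open>All representatives yield the same integer and there is at least one, so the image is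
  the singleton that \<open>the_elem\<close> expects.\<close>

lemma burnside_mark_diff:
  assumes "finite_gset G X" "finite_gset G Y" "subgroup H G"
  shows "burnside_mark H (burnside_diff G X Y) = gset_mark X H - gset_mark Y H"
proof -
  let ?m = "\<lambda>(A, B). int (card (gset_fixed A H)) - int (card (gset_fixed B H))"
  have "?m z = gset_mark X H - gset_mark Y H" if "z \<in> burnside_diff G X Y" for z
    using that assms(3) by (auto simp: burnside_diff_eq[OF assms(1,2)] gset_mark_def)
  then have "?m ` burnside_diff G X Y = {gset_mark X H - gset_mark Y H}"
    using burnside_diff_nonempty[OF assms(1,2)] by (auto simp: image_iff)
  then show ?thesis by (simp add: burnside_mark_def)
qed

text \<open>This is the injectivity of the family of mark homomorphisms; it reduces identities in
  the Burnside ring to identities between integers.\<close>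

lemma burnside_diff_eq_iff:
  assumes "finite_gset G X" "finite_gset G Y" "finite_gset G X'" "finite_gset G Y'"
  shows "burnside_diff G X Y = burnside_diff G X' Y' \<longleftrightarrow>
    (\<forall>H. subgroup H G \<longrightarrow> gset_mark X H - gset_mark Y H = gset_mark X' H - gset_mark Y' H)"
  using burnside_diff_cong[OF assms] burnside_mark_diff assms by metis

section \<open>Ring operations on formal differences\<close>

lemma UN_UN_const:
  assumes "a \<noteq> {}" "b \<noteq> {}"
    and "\<And>x y x' y'. \<lbrakk>(x, y) \<in> a; (x', y') \<in> b\<rbrakk> \<Longrightarrow> f x y x' y' = c"
  shows "(\<Union>(x, y)\<in>a. \<Union>(x', y')\<in>b. f x y x' y') = c"
  using assms by fast

text \<open>The sum is a union over all pairs of representatives. Additivity of marks makes this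
  family constant, and the classes are nonempty, so the union is the common value.\<close>

lemma burnside_diff_add:
  assumes "finite_gset G X" "finite_gset G Y" "finite_gset G X'" "finite_gset G Y'"
  shows "burnside_diff G X Y \<oplus>\<^bsub>burnside_ring G\<^esub> burnside_diff G X' Y'
    = burnside_diff G (gset_sum X X') (gset_sum Y Y')"
proof -
  have "burnside_diff G (gset_sum A A') (gset_sum B B')
      = burnside_diff G (gset_sum X X') (gset_sum Y Y')"
    if "(A, B) \<in> burnside_diff G X Y" "(A', B') \<in> burnside_diff G X' Y'" for A B A' B'
  proof (rule burnside_diff_cong)
    have gsets: "finite_gset G A" "finite_gset G B" "finite_gset G A'" "finite_gset G B'"
      using that by (simp_all add: burnside_diff_eq assms)
    then show "finite_gset G (gset_sum A A')" "finite_gset G (gset_sum B B')"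
      "finite_gset G (gset_sum X X')" "finite_gset G (gset_sum Y Y')"
      using assms by auto
    show "gset_mark (gset_sum A A') H - gset_mark (gset_sum B B') H
        = gset_mark (gset_sum X X') H - gset_mark (gset_sum Y Y') H" if H: "subgroup H G" for H
    proof -
      have "gset_mark A H - gset_mark B H = gset_mark X H - gset_mark Y H"
        "gset_mark A' H - gset_mark B' H = gset_mark X' H - gset_mark Y' H"
        using \<open>(A, B) \<in> _\<close> \<open>(A', B') \<in> _\<close> H by (simp_all add: burnside_diff_eq assms)
      then show ?thesis
        by (simp add: gset_mark_sum gsets[THEN finite_gsetD(2)] assms[THEN finite_gsetD(2)])
    qed
  qed
  then show ?thesis
    unfolding burnside_ring_def ring.select_convs monoid.select_convs
    by (intro UN_UN_const burnside_diff_nonempty assms)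
qed

text \<open>The positive and negative parts are those of the expansion of
  \<open>(X - Y) * (X' - Y')\<close>.\<close>

lemma gset_mark_diff_mult:
  assumes "finite (fst X)" "finite (fst Y)" "finite (fst X')" "finite (fst Y')"
  shows "gset_mark (gset_sum (gset_prod X X') (gset_prod Y Y')) H
      - gset_mark (gset_sum (gset_prod X Y') (gset_prod Y X')) H
    = (gset_mark X H - gset_mark Y H) * (gset_mark X' H - gset_mark Y' H)"
  using assms by (simp add: gset_mark_sum gset_mark_prod algebra_simps)

lemma burnside_diff_mult:
  assumes "finite_gset G X" "finite_gset G Y" "finite_gset G X'" "finite_gset G Y'"
  shows "burnside_diff G X Y \<otimes>\<^bsub>burnside_ring G\<^esub> burnside_diff G X' Y'
    = burnside_diff G (gset_sum (gset_prod X X') (gset_prod Y Y'))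
        (gset_sum (gset_prod X Y') (gset_prod Y X'))"
proof -
  have "burnside_diff G (gset_sum (gset_prod A A') (gset_prod B B'))
        (gset_sum (gset_prod A B') (gset_prod B A'))
      = burnside_diff G (gset_sum (gset_prod X X') (gset_prod Y Y'))
        (gset_sum (gset_prod X Y') (gset_prod Y X'))"
    if "(A, B) \<in> burnside_diff G X Y" "(A', B') \<in> burnside_diff G X' Y'" for A B A' B'
  proof (rule burnside_diff_cong)
    have gsets: "finite_gset G A" "finite_gset G B" "finite_gset G A'" "finite_gset G B'"
      using that by (simp_all add: burnside_diff_eq assms)
    then show "finite_gset G (gset_sum (gset_prod A A') (gset_prod B B'))"
      "finite_gset G (gset_sum (gset_prod A B') (gset_prod B A'))"
      "finite_gset G (gset_sum (gset_prod X X') (gset_prod Y Y'))"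
      "finite_gset G (gset_sum (gset_prod X Y') (gset_prod Y X'))"
      using assms by auto
    show "gset_mark (gset_sum (gset_prod A A') (gset_prod B B')) H
        - gset_mark (gset_sum (gset_prod A B') (gset_prod B A')) H
        = gset_mark (gset_sum (gset_prod X X') (gset_prod Y Y')) H
        - gset_mark (gset_sum (gset_prod X Y') (gset_prod Y X')) H" if H: "subgroup H G" for H
    proof -
      have "gset_mark A H - gset_mark B H = gset_mark X H - gset_mark Y H"
        "gset_mark A' H - gset_mark B' H = gset_mark X' H - gset_mark Y' H"
        using \<open>(A, B) \<in> _\<close> \<open>(A', B') \<in> _\<close> H by (simp_all add: burnside_diff_eq assms)
      then show ?thesis
        by (simp add: gset_mark_diff_mult gsets[THEN finite_gsetD(2)] assms[THEN finite_gsetD(2)])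
    qed
  qed
  then show ?thesis
    unfolding burnside_ring_def ring.select_convs monoid.select_convs
    by (intro UN_UN_const burnside_diff_nonempty assms)
qed

text \<open>The additive inverse is a definite description, so its uniqueness has to be shown too;
  it follows by cancelling marks, with no appeal to the ring axioms.\<close>

lemma burnside_diff_minus:
  assumes X: "finite_gset G X" and Y: "finite_gset G Y"
  shows "\<ominus>\<^bsub>burnside_ring G\<^esub> burnside_diff G X Y = burnside_diff G Y X"
proof -
  have G: "group G" using X finite_gsetD(3) by blast
  have zero: "\<zero>\<^bsub>burnside_ring G\<^esub> = burnside_diff G gset_empty gset_empty"
    by (simp add: burnside_ring_def burnside_class_def)
  show ?thesis
    unfolding a_inv_def m_inv_def
  proof (rule the_equality)
    show "burnside_diff G Y X \<in> carrier (add_monoid (burnside_ring G))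
        \<and> burnside_diff G X Y \<otimes>\<^bsub>add_monoid (burnside_ring G)\<^esub> burnside_diff G Y X
          = \<one>\<^bsub>add_monoid (burnside_ring G)\<^esub>
        \<and> burnside_diff G Y X \<otimes>\<^bsub>add_monoid (burnside_ring G)\<^esub> burnside_diff G X Y
          = \<one>\<^bsub>add_monoid (burnside_ring G)\<^esub>"
      using X Y G by (auto simp: burnside_diff_add burnside_diff_closed zero burnside_diff_eq_iff
          gset_mark_sum finite_gsetD(2) finite_gset_sum finite_gset_empty)
  next
    fix b
    assume b: "b \<in> carrier (add_monoid (burnside_ring G))
        \<and> burnside_diff G X Y \<otimes>\<^bsub>add_monoid (burnside_ring G)\<^esub> b = \<one>\<^bsub>add_monoid (burnside_ring G)\<^esub>
        \<and> b \<otimes>\<^bsub>add_monoid (burnside_ring G)\<^esub> burnside_diff G X Y = \<one>\<^bsub>add_monoid (burnside_ring G)\<^esub>"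
    then have "b \<in> carrier (burnside_ring G)" by simp
    then obtain A B :: "('a, nat) gset" where AB: "finite_gset G A" "finite_gset G B" "b = burnside_diff G A B"
      by (rule burnside_carrierE)
    have "burnside_diff G (gset_sum X A) (gset_sum Y B) = burnside_diff G gset_empty gset_empty"
      using b X Y AB by (simp add: burnside_diff_add zero)
    then have "\<forall>H. subgroup H G \<longrightarrow> gset_mark A H - gset_mark B H = gset_mark Y H - gset_mark X H"
      using X Y AB G by (simp add: burnside_diff_eq_iff gset_mark_sum finite_gsetD(2)
          finite_gset_sum finite_gset_empty algebra_simps)
    then show "b = burnside_diff G Y X"
      using X Y AB by (simp add: burnside_diff_eq_iff)
  qed
qed


section \<open>Maximal subgroups of p-groups\<close>

text \<open>In a p-group a proper subgroup is properly contained in its normalizer, which by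
  maximality must be the whole group.\<close>

lemma (in group) maximal_subgroup_p_group_normal:
  assumes p: "prime p" and fin: "finite (carrier G)" and ord: "order G = p ^ n"
    and max: "maximal_subgroup M G"
  shows "M \<lhd> G"
proof -
  have M: "subgroup M G" "M \<noteq> carrier G"
    and max: "\<And>K. \<lbrakk>subgroup K G; M \<subseteq> K\<rbrakk> \<Longrightarrow> K = M \<or> K = carrier G"
    using max by (auto simp: maximal_subgroup_def)
  have Msub: "M \<subseteq> carrier G" using M subgroup.subset by blast
  \<comment> \<open>The normalizer of \<open>M\<close>, written with cosets to match the definition
    of a normal subgroup.\<close>
  let ?N = "{g \<in> carrier G. M #> g = g <# M}"
  have "subgroup ?N G"
  proof (rule subgroupI)
    show "?N \<noteq> {}"
      using coset_join2[OF _ M(1)] coset_join3[OF _ M(1)] subgroup.one_closed[OF M(1)] by force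
    show "inv g \<in> ?N" if "g \<in> ?N" for g
    proof -
      have g: "g \<in> carrier G" "M #> g = g <# M" using that by auto
      have "M #> g #> inv g = M" using g(1) Msub by (simp add: coset_mult_assoc)
      then have "inv g <# M = inv g <# (M #> g #> inv g)" by simp
      also have "\<dots> = inv g <# (g <# M #> inv g)" using g by simp
      also have "\<dots> = inv g <# (g <# (M #> inv g))" using g Msub by (simp add: coset_assoc)
      also have "\<dots> = M #> inv g"
        using g Msub by (simp add: lcos_m_assoc r_coset_subset_G lcos_mult_one)
      finally show ?thesis using g by simp
    qed
    show "g \<otimes> h \<in> ?N" if "g \<in> ?N" "h \<in> ?N" for g h
    proof -
      have g: "g \<in> carrier G" "M #> g = g <# M" and h: "h \<in> carrier G" "M #> h = h <# M"
        using that by auto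
      have "M #> (g \<otimes> h) = g <# M #> h" using g h Msub by (simp flip: coset_mult_assoc)
      also have "\<dots> = g \<otimes> h <# M" using g h Msub by (simp flip: coset_assoc add: lcos_m_assoc)
      finally show ?thesis using g h by simp
    qed
  qed auto
  moreover have "M \<subseteq> ?N"
    using coset_join2[OF _ M(1)] coset_join3[OF _ M(1)] Msub by auto
  moreover have "?N \<noteq> M"
  proof -
    \<comment> \<open>\<open>M\<close> acts on its left cosets and fixes itself; counting modulo \<open>p\<close> gives a second fixed
      coset, whose representatives normalize \<open>M\<close>.\<close>
    let ?X = "gset_cosets G M" and ?GM = "G\<lparr>carrier := M\<rparr>"
    have X: "finite_gset G ?X" using finite_gset_cosets[OF is_group fin M(1)] .
    interpret X: group_action ?GM "fst ?X" "snd ?X"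
      using finite_gsetD[OF X] subgroup_imp_group[OF M(1)] subsetD[OF Msub]
      by (intro group_actionI) (simp_all add: gset_cosets_def)
    have "card (lcosets M) * card M = p ^ n"
      using l_lagrange[OF fin M(1)] ord by simp
    then have "card M dvd p ^ n" "card (lcosets M) dvd p ^ n"
      by (metis dvd_triv_right, metis dvd_triv_left)
    then obtain k l where k: "card M = p ^ k" and l: "card (lcosets M) = p ^ l"
      unfolding divides_primepow_nat[OF p] by blast
    let ?F = "{C \<in> lcosets M. \<forall>m\<in>M. m <# C = C}"
    have cong: "[card (lcosets M) = card ?F] (mod p)"
      using X.card_fixed_cong[OF p, of k] k finite_gsetD(2)[OF X]
      by (simp add: order_def gset_cosets_def cong: conj_cong)
    \<comment> \<open>Exponent 0 would mean index 1, but \<open>M\<close> is proper.\<close>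
    have "l \<noteq> 0"
      using l l_lagrange[OF fin M(1)] M(2) Msub fin
      by (metis card_subset_eq mult_1 order_def power_0)
    then have "p dvd card (lcosets M)" unfolding l by simp
    then have "p dvd card ?F" using cong_dvd_iff[OF cong] by simp
    then have "?F \<noteq> {M}" using p not_prime_1 by auto
    moreover have "M = \<one> <# M" using lcos_mult_one[OF Msub] by simp
    then have "M \<in> lcosets M" unfolding LCOSETS_def by blast
    then have "M \<in> ?F" using coset_join3[OF _ M(1)] Msub by blast
    ultimately obtain C where C: "C \<in> ?F" "C \<noteq> M" by blast
    then obtain g where g: "g \<in> carrier G" "C = g <# M" by (auto simp: LCOSETS_def)
    have gM: "g \<in> g <# M" using lcos_self g M(1) by blast
    have "M #> g \<subseteq> g <# M"
    proof
      fix x assume "x \<in> M #> g"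
      then obtain m where m: "m \<in> M" "x = m \<otimes> g" by (auto simp: r_coset_def)
      then have "x \<in> m <# (g <# M)" using gM unfolding l_coset_def[of _ m] by blast
      then show "x \<in> g <# M" using C g m by auto
    qed
    \<comment> \<open>Equal finite cardinalities upgrade the inclusion of cosets to an
      equality.\<close>
    moreover have "card (M #> g) = card (g <# M)"
    proof -
      have "card (M #> g) = card M"
        using card_rcosets_equal[OF rcosetsI[OF Msub g(1)] Msub] by simp
      also have "\<dots> = card (g <# M)"
        using l_card_cosets_equal[OF _ Msub fin, of "g <# M"] C(1) g(2) by simp
      finally show ?thesis .
    qed
    moreover have "finite (g <# M)" using fin g Msub by (meson finite_subset l_coset_subset_G)
    ultimately have "g \<in> ?N" using g card_subset_eq by blast
    moreover have "g \<notin> M" using C g coset_join3[OF _ M(1)] by auto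
    ultimately show ?thesis by blast
  qed
  ultimately have "?N = carrier G" using max by blast
  then show ?thesis using M(1) by (auto simp: normal_def normal_axioms_def is_group)
qed

text \<open>The nontrivial p-group \<open>G Mod M\<close> has a subgroup \<open>A\<close> of order
  \<open>p\<close>. Its preimage \<open>\<Union>A\<close> contains \<open>M\<close>, so by
  maximality it is \<open>M\<close> or everything; the first is impossible and the second makes
  \<open>A\<close> the whole quotient.\<close>

lemma (in group) maximal_subgroup_p_group_index:
  assumes p: "prime p" and fin: "finite (carrier G)" and ord: "order G = p ^ n"
    and max: "maximal_subgroup M G"
  shows "card (lcosets M) = p"
proof -
  have M: "subgroup M G" "M \<noteq> carrier G" "M \<subseteq> carrier G"
    using max subgroup.subset by (auto simp: maximal_subgroup_def)
  interpret normal M G using maximal_subgroup_p_group_normal assms .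
  \<comment> \<open>The quotient consists of right cosets while the claim counts left ones; the two
    forms of Lagrange's theorem equate the numbers.\<close>
  have eq: "card (rcosets M) * card M = card (lcosets M) * card M"
    using lagrange[OF M(1)] l_lagrange[OF fin M(1)] by simp
  have cM: "card M \<noteq> 0" using fin M by (metis card_0_eq empty_iff finite_subset one_closed)
  have index: "card (lcosets M) = order (G Mod M)"
    using eq cM by (simp add: order_def FactGroup_def)
  obtain k where k: "order (G Mod M) = p ^ k"
    using l_lagrange[OF fin M(1)] index ord p by (metis divides_primepow_nat dvd_triv_left)
  have "k \<noteq> 0"
  proof
    assume "k = 0"
    then have "card M = card (carrier G)"
      using l_lagrange[OF fin M(1)] index k by (simp add: order_def)
    then show False using M fin card_subset_eq by blast
  qed
  \<comment> \<open>Sylow's theorem with exponent 1 amounts to the existence of a subgroup of order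
    \<open>p\<close>; the other factor may still be divisible by \<open>p\<close>.\<close>
  then have "order (G Mod M) = p ^ 1 * p ^ (k - 1)"
    using k by (metis power_one_right power_minus_mult mult.commute neq0_conv)
  \<comment> \<open>An infinite set has \<open>card\<close> 0, which is not a power of
    \<open>p\<close>.\<close>
  moreover have "finite (carrier (G Mod M))"
    using k p by (metis card.infinite order_def power_eq_0_iff not_prime_0)
  ultimately obtain A where A: "subgroup A (G Mod M)" "card A = p"
    using sylow_thm[OF p factorgroup_is_group] by (metis power_one_right)
  have K: "subgroup (\<Union>A) G" "\<Union>A = {x \<in> carrier G. M #> x \<in> A}"
    using factgroup_subgroup_union_subgroup factgroup_subgroup_union_char A by auto
  have MA: "M \<in> A" using subgroup.one_closed[OF A(1)] by simp
  then have "\<Union>A = M \<or> \<Union>A = carrier G"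
    using max K(1) by (auto simp: maximal_subgroup_def)
  then show ?thesis
  proof
    assume *: "\<Union>A = M"
    have "A \<subseteq> {M}"
    proof
      fix C assume C: "C \<in> A"
      then have "C \<in> rcosets M" using subgroup.subset[OF A(1)] by (auto simp: FactGroup_def)
      then obtain g where g: "g \<in> carrier G" "C = M #> g" by (auto simp: RCOSETS_def)
      then have "g \<in> M" using * K(2) C by auto
      then show "C \<in> {M}" using g coset_join2[OF _ M(1)] by auto
    qed
    then have "A = {M}" using MA by auto
    \<comment> \<open>Contradiction: \<open>A\<close> would have one element, but its order is the
      prime \<open>p\<close>.\<close>
    then show ?thesis using A p by auto
  next
    assume *: "\<Union>A = carrier G"
    have "carrier (G Mod M) \<subseteq> A"
      using K(2) * by (auto simp: FactGroup_def RCOSETS_def)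
    then have "carrier (G Mod M) = A" using subgroup.subset[OF A(1)] by auto
    then show ?thesis using A index by (simp add: order_def)
  qed
qed


section \<open>The unit of a maximal subgroup\<close>

text \<open>Every coset of a normal subgroup \<open>N\<close> has stabilizer \<open>N\<close>, so
  \<open>P\<close> fixes either all cosets or none.\<close>

lemma gset_mark_cosets_normal:
  fixes G (structure)
  assumes "N \<lhd> G" "P \<subseteq> carrier G"
  shows "gset_mark (gset_cosets G N) P = (if P \<subseteq> N then int (card (lcosets N)) else 0)"
proof -
  interpret normal N G by fact
  have "h <# (g <# N) = g <# N \<longleftrightarrow> h \<in> N" if "h \<in> carrier G" "g \<in> carrier G" for g h
  proof -
    \<comment> \<open>Normality allows a passage to right cosets, where the condition becomes
      membership of \<open>(h \<otimes> g) \<otimes> inv g\<close>, that is, of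
      \<open>h\<close>.\<close>
    have "h <# (g <# N) = g <# N \<longleftrightarrow> N #> (h \<otimes> g) = N #> g"
      using that subset by (simp add: lcos_m_assoc coset_eq)
    also have "\<dots> \<longleftrightarrow> (h \<otimes> g) \<otimes> inv g \<in> N"
      using that by (metis coset_join1 coset_join2 coset_mult_inv1 coset_mult_inv2 inv_closed
          is_subgroup m_closed subset)
    also have "(h \<otimes> g) \<otimes> inv g = h" using that by (simp add: m_assoc)
    finally show ?thesis .
  qed
  then have "gset_fixed (gset_cosets G N) P = (if P \<subseteq> N then lcosets N else {})"
    using assms(2) by (auto simp: gset_fixed_def gset_cosets_def LCOSETS_def subset_iff)
  then show ?thesis by (simp add: gset_mark_def)
qed

context
  fixes S :: "('g, 'm) monoid_scheme" and M :: "'g set" and n :: nat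
  assumes S: "group S" "finite (carrier S)" "order S = 2 ^ n" and M: "maximal_subgroup M S"
begin

interpretation group S by (rule S)

text \<open>The empty G-sets brought in by \<open>burnside_class\<close> have mark 0 and drop
  out.\<close>

lemma burnside_v_diff:
  "burnside_v S M = burnside_diff S (gset_cosets S (carrier S)) (gset_cosets S M)"
  and finite_gset_v: "finite_gset S (gset_cosets S (carrier S))" "finite_gset S (gset_cosets S M)"
proof -
  have *: "finite_gset S (gset_cosets S (carrier S))" "finite_gset S (gset_cosets S M)"
    using S M subgroup_self by (auto simp: maximal_subgroup_def)
  then show "finite_gset S (gset_cosets S (carrier S))" "finite_gset S (gset_cosets S M)" by auto
  show "burnside_v S M = burnside_diff S (gset_cosets S (carrier S)) (gset_cosets S M)"
    using * S(1) by (simp add: burnside_v_def a_minus_def burnside_class_def burnside_diff_minus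
        burnside_diff_add burnside_diff_eq_iff finite_gset_empty finite_gset_sum gset_mark_sum
        *[THEN finite_gsetD(2)] finite_gset_empty[OF S(1), THEN finite_gsetD(2)])
qed

text \<open>The value is 1 - 2 or 1 - 0: the single point of \<open>S/S\<close> is always fixed, and
  the two points of \<open>S/M\<close> are fixed together or not at all.\<close>

lemma gset_mark_v:
  assumes "subgroup P S"
  shows "gset_mark (gset_cosets S (carrier S)) P - gset_mark (gset_cosets S M) P
    = (if P \<subseteq> M then - 1 else 1)"
proof -
  have P: "P \<subseteq> carrier S" using assms subgroup.subset by blast
  \<comment> \<open>As \<open>carrier S\<close> is normal too, one formula for marks covers both
    coset spaces.\<close>
  have "carrier S \<lhd> S" by (rule normal_invI[OF subgroup_self]) auto
  moreover have "card (lcosets\<^bsub>S\<^esub> (carrier S)) = 1"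
    using l_lagrange[OF S(2) subgroup_self] S(2)
    by (metis S(3) mult_eq_self_implies_10 order_def power_not_zero zero_neq_numeral mult.commute)
  moreover have "M \<lhd> S" "card (lcosets\<^bsub>S\<^esub> M) = 2"
    using maximal_subgroup_p_group_normal[OF two_is_prime_nat S(2,3) M]
      maximal_subgroup_p_group_index[OF two_is_prime_nat S(2,3) M] by auto
  ultimately show ?thesis using P by (simp add: gset_mark_cosets_normal)
qed

lemma burnside_mark_v:
  "subgroup P S \<Longrightarrow> burnside_mark P (burnside_v S M) = (if P \<subseteq> M then - 1 else 1)"
  by (simp add: burnside_v_diff burnside_mark_diff finite_gset_v gset_mark_v)

lemma burnside_v_closed: "burnside_v S M \<in> carrier (burnside_ring S)"
  by (simp add: burnside_v_diff burnside_diff_closed finite_gset_v)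

text \<open>All marks of the square are squares of 1 or -1, hence equal to the marks of the
  one-point G-set.\<close>

lemma burnside_v_square:
  "burnside_v S M \<otimes>\<^bsub>burnside_ring S\<^esub> burnside_v S M = \<one>\<^bsub>burnside_ring S\<^esub>"
proof -
  have one: "\<one>\<^bsub>burnside_ring S\<^esub> = burnside_diff S gset_point gset_empty"
    by (simp add: burnside_ring_def burnside_class_def)
  note v = finite_gset_v
  show ?thesis
    unfolding burnside_v_diff burnside_diff_mult[OF v v] one
    by (subst burnside_diff_eq_iff)
      (use v S(1) in \<open>auto simp: gset_mark_diff_mult finite_gsetD(2) gset_mark_v\<close>)
qed

lemma burnside_v_Units_iff:
  "burnside_v S M \<in> Units (fusion_burnside_ring S F) \<longleftrightarrow>
    (\<forall>P Q. subgroup P S \<and> subgroup Q S \<and> F_conj F P Q \<longrightarrow> (P \<subseteq> M \<longleftrightarrow> Q \<subseteq> M))"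
proof -
  \<comment> \<open>Being its own inverse, the element is a unit as soon as it belongs to the
    subring.\<close>
  have "burnside_v S M \<in> Units (fusion_burnside_ring S F) \<longleftrightarrow>
      burnside_v S M \<in> carrier (fusion_burnside_ring S F)"
    using burnside_v_square by (auto simp: Units_def fusion_burnside_ring_def)
  \<comment> \<open>The two possible marks differ, so equality of marks at \<open>P\<close> and
    \<open>Q\<close> says exactly that both or neither lie in \<open>M\<close>.\<close>
  also have "\<dots> \<longleftrightarrow>
      (\<forall>P Q. subgroup P S \<and> subgroup Q S \<and> F_conj F P Q \<longrightarrow> (P \<subseteq> M \<longleftrightarrow> Q \<subseteq> M))"
    using burnside_v_closed by (auto simp: fusion_burnside_ring_def burnside_mark_v split: if_splits)
  finally show ?thesis .
qed

end


section \<open>Strongly closed subgroups\<close>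

lemma F_conj_sym: "F_conj F P Q \<Longrightarrow> F_conj F Q P"
  by (auto simp: F_conj_def F_iso_def)

lemma (in fusion_system) F_iso_image:
  assumes "subgroup P S" "subgroup Q S" "\<phi> \<in> F_iso F P Q"
  shows "\<phi> ` P = Q"
proof -
  obtain \<psi> where \<psi>: "\<psi> \<in> F Q P" "compose Q \<phi> \<psi> = (\<lambda>x\<in>Q. x)" and \<phi>: "\<phi> \<in> F P Q"
    using assms(3) by (auto simp: F_iso_def)
  have maps: "\<phi> ` P \<subseteq> Q" "\<psi> ` Q \<subseteq> P"
    using F_morphism[OF assms(1,2) \<phi>] F_morphism[OF assms(2,1) \<psi>(1)] by (auto simp: hom_def)
  moreover have "\<phi> (\<psi> y) = y" if "y \<in> Q" for y
    using fun_cong[OF \<psi>(2), of y] that by (simp add: compose_eq)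
  ultimately show ?thesis by force
qed

text \<open>Restricting \<open>\<phi>\<close> to the cyclic group of \<open>x\<close> and cutting
  the codomain down to the image gives an isomorphism in \<open>F\<close> between the cyclic groups
  of \<open>x\<close> and \<open>\<phi> x\<close>.\<close>

lemma (in fusion_system) F_iso_in_F_class:
  assumes P: "subgroup P S" and Q: "subgroup Q S" and \<phi>: "\<phi> \<in> F_iso F P Q" and x: "x \<in> P"
  shows "\<phi> x \<in> F_class S F x"
proof -
  let ?X = "generate S {x}"
  have xS: "x \<in> carrier S" using P x subgroup.mem_carrier by fast
  have X: "subgroup ?X S" using generate_is_subgroup xS by simp
  have XP: "?X \<subseteq> P" using generate_subgroup_incl P x by simp
  have xX: "x \<in> ?X" by (simp add: generate.incl)
  \<comment> \<open>The inclusion is conjugation by the identity, hence a morphism of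
    \<open>F\<close>; composing with it restricts \<open>\<phi>\<close>.\<close>
  have "conj_map S ?X \<one> = (\<lambda>z\<in>?X. z)"
    using subgroup.subset[OF X] by (auto simp: conj_map_def fun_eq_iff restrict_def)
  then have "(\<lambda>z\<in>?X. z) \<in> conj_hom S ?X P"
    using XP by (force simp: conj_hom_def)
  then have incl: "(\<lambda>z\<in>?X. z) \<in> F ?X P" using conj_hom_subset[OF X P] by blast
  have "\<phi> \<in> F P Q" using \<phi> by (simp add: F_iso_def)
  then have "compose ?X \<phi> (\<lambda>z\<in>?X. z) \<in> F ?X Q" using compose_closed[OF X P Q incl] by blast
  then obtain R \<rho> where R: "subgroup R S" and \<rho>: "\<rho> \<in> F_iso F ?X R"
    and eq: "compose ?X \<phi> (\<lambda>z\<in>?X. z) = compose ?X (\<lambda>z\<in>R. z) \<rho>"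
    using iso_inclusion[OF X Q] by blast
  have img: "\<rho> ` ?X = R" using F_iso_image[OF X R \<rho>] .
  have val: "\<rho> x = \<phi> x"
    using fun_cong[OF eq, of x] xX img by (auto simp: compose_eq)
  have hom: "\<rho> \<in> hom (S\<lparr>carrier := ?X\<rparr>) (S\<lparr>carrier := R\<rparr>)"
    using F_morphism[OF X R, of \<rho>] \<rho> by (simp add: F_iso_def)
  interpret \<rho>: group_hom "S\<lparr>carrier := ?X\<rparr>" "S\<lparr>carrier := R\<rparr>" \<rho>
    using hom subgroup_imp_group X R by (simp add: group_hom_def group_hom_axioms_def)
  \<comment> \<open>Homomorphisms map generated subgroups to generated subgroups, so
    \<open>R\<close> is the cyclic group of \<open>\<phi> x\<close>.\<close>
  have "generate S {\<rho> x} = generate (S\<lparr>carrier := R\<rparr>) (\<rho> ` {x})"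
    using generate_consistent[of "{\<rho> x}" R] R img xX by auto
  also have "\<dots> = \<rho> ` generate (S\<lparr>carrier := ?X\<rparr>) {x}"
    using \<rho>.generate_img[of "{x}"] xX by simp
  also have "\<dots> = R" using generate_consistent[of "{x}" ?X] X xX img by simp
  finally have "\<rho> \<in> F_iso F ?X (generate S {\<phi> x})" using \<rho> val by simp
  moreover have "\<phi> x \<in> carrier S"
    using val img xX subgroup.mem_carrier[OF R] by force
  ultimately show ?thesis using val by (auto simp: F_class_def)
qed

text \<open>An isomorphism in \<open>F\<close> moves each element within its class, so strong
  closure passes from elements to subgroups; cyclic subgroups give the way back.\<close>

lemma (in fusion_system) strongly_closed_iff:
  assumes M: "subgroup M S"
  shows "strongly_closed S F M \<longleftrightarrow>
    (\<forall>P Q. subgroup P S \<and> subgroup Q S \<and> F_conj F P Q \<longrightarrow> (P \<subseteq> M \<longleftrightarrow> Q \<subseteq> M))" (is "_ \<longleftrightarrow> ?inv")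
proof
  assume sc: "strongly_closed S F M"
  have "Q \<subseteq> M" if PQ: "subgroup P S" "subgroup Q S" "F_conj F P Q" "P \<subseteq> M" for P Q
  proof -
    obtain \<phi> where \<phi>: "\<phi> \<in> F_iso F P Q" using PQ by (auto simp: F_conj_def)
    have "\<phi> ` P \<subseteq> M"
      using F_iso_in_F_class[OF PQ(1,2) \<phi>] sc PQ(4) by (auto simp: strongly_closed_def)
    then show ?thesis using F_iso_image[OF PQ(1,2) \<phi>] by simp
  qed
  \<comment> \<open>Symmetry of conjugacy supplies the reverse implication.\<close>
  then show ?inv using F_conj_sym by blast
next
  assume inv: ?inv
  have "y \<in> M" if x: "x \<in> M" and y: "y \<in> F_class S F x" for x y
  proof -
    have "x \<in> carrier S" "y \<in> carrier S"
      using x y subgroup.mem_carrier[OF M] by (auto simp: F_class_def)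
    then have "subgroup (generate S {x}) S" "subgroup (generate S {y}) S"
      using generate_is_subgroup by auto
    moreover have "F_conj F (generate S {x}) (generate S {y})"
      using y by (auto simp: F_class_def F_conj_def)
    moreover have "generate S {x} \<subseteq> M" using generate_subgroup_incl M x by simp
    ultimately have "generate S {y} \<subseteq> M" using inv by blast
    then show ?thesis using generate.incl[of y "{y}" S] by auto
  qed
  then show "strongly_closed S F M" using M by (auto simp: strongly_closed_def)
qed

theorem proposition8p2:
  fixes S :: "('a, 'm) monoid_scheme" and F :: "'a hom_family" and M :: "'a set"
  assumes "saturated_fusion_system S 2 F"
    and "maximal_subgroup M S"
  shows "burnside_v S M \<in> Units (fusion_burnside_ring S F) \<longleftrightarrow> strongly_closed S F M"
proof -
  interpret saturated_fusion_system S 2 F by fact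
  obtain n where n: "order S = 2 ^ n" using p_group(2) by auto
  have "subgroup M S" using assms(2) by (simp add: maximal_subgroup_def)
  then show ?thesis
    using burnside_v_Units_iff[OF is_group p_group(1) n assms(2)] strongly_closed_iff by simp
qed

end
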